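(* Let $\mathbb{K}$ be $\mathbb{R}$ or $\mathbb{C}$. Then $\theta\mathbb{K}$ is a Wallman compactification of $\eta_{\mathbb{K}}(\mathbb{K})$.
   Context: $\mathbb{K}$ carries its usual topology. $\mathcal{D}(\mathbb{K})$ is the collection of all closed discrete subsets of $\mathbb{K}$ together with the special member $\mathbb{K}$ itself. A discrete $z$-filter on $\mathbb{K}$ is a collection $\mathcal{F}$ of members of $\mathcal{D}(\mathbb{K})$ such that $\emptyset\notin\mathcal{F}$; $D_1,D_2\in\mathcal{F}$ implies $D_1\cap D_2\in\mathcal{F}$; and $D_1\in\mathcal{F}$, $D\in\mathcal{D}(\mathbb{K})$, $D_1\subseteq D$ imply $D\in\mathcal{F}$. A discrete $z$-ultrafilter is a discrete $z$-filter that is maximal under inclusion. $\theta\mathbb{K}$ is the set of all discrete $z$-ultrafilters on $\mathbb{K}$, regarded as an index set: $\mathcal{D}^p$ is the discrete $z$-ultrafilter corresponding to the point $p\in\theta\mathbb{K}$. It is topologized by taking as basic closed sets the sets $\overline{Z}=\{p\in\theta\mathbb{K}: Z\in\mathcal{D}^p\}$, for $Z$ a closed discrete subset of $\mathbb{K}$. The map $\eta_{\mathbb{K}}:\mathbb{K}\to\theta\mathbb{K}$ sends $a\in\mathbb{K}$ to the point given by the discrete $z$-ultrafilter $\mathcal{D}_a$ fixed at $a$ (all of whose members contain $a$), and $\eta_{\mathbb{K}}(\mathbb{K})$ has the subspace topology of $\theta\mathbb{K}$. The Wallman compactification of a $T_1$ space $X$ is the space of all ultrafilters in the lattice of closed subsets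 of $X$, with the sets $\{\mathcal{U}: A\in\mathcal{U}\}$, $A$ closed in $X$, as a base for the closed sets, and $X$ embedded by sending a point $x$ to the ultrafilter of all closed sets containing $x$. *)

theory Defs
  imports "HOL-Analysis.Analysis"
begin

text \<open>The topology on the point set \<open>P\<close> with the family \<open>\<B>\<close> as a base for its closed sets. This
  is a topology on \<open>P\<close> as soon as \<open>\<B>\<close> contains the empty set and is closed under binary unions
  (see \<open>openin_topology_with_closed_base\<close> below); both uses in this theory are of this kind.\<close>

definition topology_with_closed_base :: "'p set \<Rightarrow> 'p set set \<Rightarrow> 'p topology" where
  "topology_with_closed_base P \<B> = topology (arbitrary union_of (\<lambda>U. \<exists>C\<in>\<B>. U = P - C))"

text \<open>The family \<open>\<D>(\<K>)\<close>. Here and below \<open>\<K>\<close> is the type \<^typ>\<open>'a\<close>.\<close>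

definition closed_discrete_sets :: "'a::topological_space set set" where
  "closed_discrete_sets = insert UNIV {Z. closed Z \<and> discrete Z}"

definition discrete_z_filter :: "'a::topological_space set set \<Rightarrow> bool" where
  "discrete_z_filter F \<longleftrightarrow>
     F \<subseteq> closed_discrete_sets \<and> {} \<notin> F \<and>
     (\<forall>D1\<in>F. \<forall>D2\<in>F. D1 \<inter> D2 \<in> F) \<and>
     (\<forall>D1\<in>F. \<forall>D\<in>closed_discrete_sets. D1 \<subseteq> D \<longrightarrow> D \<in> F)"

definition discrete_z_ultrafilter :: "'a::topological_space set set \<Rightarrow> bool" where
  "discrete_z_ultrafilter F \<longleftrightarrow>
     discrete_z_filter F \<and> (\<forall>G. discrete_z_filter G \<and> F \<subseteq> G \<longrightarrow> G = F)"

text \<open>A point \<open>p\<close> of \<open>\<theta>\<K>\<close> is identified with the ultrafilter \<open>\<D>\<^sup>p\<close> that it indexes.\<close>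

definition theta :: "'a::topological_space set set topology" where
  "theta = topology_with_closed_base {p. discrete_z_ultrafilter p}
     {{p. discrete_z_ultrafilter p \<and> Z \<in> p} | Z. closed Z \<and> discrete Z}"

definition eta :: "'a::topological_space \<Rightarrow> 'a set set" where
  "eta a = {D \<in> closed_discrete_sets. a \<in> D}"

definition closed_filter :: "'b topology \<Rightarrow> 'b set set \<Rightarrow> bool" where
  "closed_filter X F \<longleftrightarrow>
     F \<noteq> {} \<and> F \<subseteq> {A. closedin X A} \<and> {} \<notin> F \<and>
     (\<forall>A\<in>F. \<forall>B\<in>F. A \<inter> B \<in> F) \<and>
     (\<forall>A\<in>F. \<forall>B. closedin X B \<and> A \<subseteq> B \<longrightarrow> B \<in> F)"

definition closed_ultrafilter :: "'b topology \<Rightarrow> 'b set set \<Rightarrow> bool" where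
  "closed_ultrafilter X F \<longleftrightarrow>
     closed_filter X F \<and> (\<forall>G. closed_filter X G \<and> F \<subseteq> G \<longrightarrow> G = F)"

definition wallman_space :: "'b topology \<Rightarrow> 'b set set topology" where
  "wallman_space X = topology_with_closed_base {u. closed_ultrafilter X u}
     {{u. closed_ultrafilter X u \<and> A \<in> u} | A. closedin X A}"

definition wallman_embedding :: "'b topology \<Rightarrow> 'b \<Rightarrow> 'b set set" where
  "wallman_embedding X x = {A. closedin X A \<and> x \<in> A}"

text \<open>The space \<open>Y\<close> is a Wallman compactification of its subspace \<open>S\<close>: the subspace is \<open>T\<^sub>1\<close>, and
  \<open>Y\<close> is homeomorphic to the Wallman space of \<open>S\<close> by a map that restricts on \<open>S\<close> to the canonical
  embedding.\<close>

definition wallman_compactification_of :: "'b topology \<Rightarrow> 'b set \<Rightarrow> bool" where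
  "wallman_compactification_of Y S \<longleftrightarrow>
     S \<subseteq> topspace Y \<and> t1_space (subtopology Y S) \<and>
     (\<exists>h. homeomorphic_map Y (wallman_space (subtopology Y S)) h \<and>
          (\<forall>x\<in>S. h x = wallman_embedding (subtopology Y S) x))"

lemma openin_topology_with_closed_base:
  assumes "\<And>B C. B \<in> \<B> \<Longrightarrow> C \<in> \<B> \<Longrightarrow> B \<union> C \<in> \<B>"
  shows "openin (topology_with_closed_base P \<B>) =
           arbitrary union_of (\<lambda>U. \<exists>C\<in>\<B>. U = P - C)"
  unfolding topology_with_closed_base_def
proof (rule topology_inverse', rule istopology_base)
  fix S T assume "\<exists>C\<in>\<B>. S = P - C" "\<exists>C\<in>\<B>. T = P - C"
  then show "\<exists>C\<in>\<B>. S \<inter> T = P - C"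
    using assms by (metis Diff_Un)
qed

lemma topspace_topology_with_closed_base:
  assumes "\<And>B C. B \<in> \<B> \<Longrightarrow> C \<in> \<B> \<Longrightarrow> B \<union> C \<in> \<B>" and "{} \<in> \<B>"
  shows "topspace (topology_with_closed_base P \<B>) = P"
proof
  have op: "openin (topology_with_closed_base P \<B>) =
      arbitrary union_of (\<lambda>U. \<exists>C\<in>\<B>. U = P - C)"
    by (rule openin_topology_with_closed_base) (fact assms(1))
  have "openin (topology_with_closed_base P \<B>) (topspace (topology_with_closed_base P \<B>))"
    by (rule openin_topspace)
  then show "topspace (topology_with_closed_base P \<B>) \<subseteq> P"
    unfolding op union_of_def by blast
  have "openin (topology_with_closed_base P \<B>) P"
    unfolding op
    by (rule arbitrary_union_of_inc) (use assms(2) in blast)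
  then show "P \<subseteq> topspace (topology_with_closed_base P \<B>)"
    by (rule openin_subset)
qed

lemma maximal_filter_prime:
  assumes F: "F \<subseteq> L" "{} \<notin> F" "\<And>A B. A \<in> F \<Longrightarrow> B \<in> F \<Longrightarrow> A \<inter> B \<in> F"
    and mx: "\<And>G. \<lbrakk>G \<subseteq> L; {} \<notin> G; \<forall>A\<in>G. \<forall>B\<in>G. A \<inter> B \<in> G; \<forall>A\<in>G. \<forall>B\<in>L. A \<subseteq> B \<longrightarrow> B \<in> G; F \<subseteq> G\<rbrakk>
                  \<Longrightarrow> G = F"
    and L: "\<And>A B. A \<in> L \<Longrightarrow> B \<in> L \<Longrightarrow> A \<inter> B \<in> L"
    and AB: "A \<in> L" "B \<in> L" "A \<union> B \<in> F"
  shows "A \<in> F \<or> B \<in> F"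
proof (rule ccontr)
  assume neg: "\<not> (A \<in> F \<or> B \<in> F)"
  have disj: "\<exists>C\<in>F. C \<inter> D = {}" if D: "D \<in> L" "D \<notin> F" for D
  proof (rule ccontr)
    assume n: "\<not> (\<exists>C\<in>F. C \<inter> D = {})"
    define G where "G = {E \<in> L. \<exists>C\<in>F. C \<inter> D \<subseteq> E}"
    have "G = F"
    proof (rule mx)
      show "\<forall>A\<in>G. \<forall>B\<in>G. A \<inter> B \<in> G"
      proof (intro ballI)
        fix A B assume "A \<in> G" "B \<in> G"
        then obtain C C' where "A \<in> L" "B \<in> L" "C \<in> F" "C' \<in> F" "C \<inter> D \<subseteq> A" "C' \<inter> D \<subseteq> B"
          unfolding G_def by blast
        then have "A \<inter> B \<in> L" "C \<inter> C' \<in> F" "(C \<inter> C') \<inter> D \<subseteq> A \<inter> B"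
          using L F(3) by auto
        then show "A \<inter> B \<in> G" unfolding G_def by blast
      qed
      show "\<forall>A\<in>G. \<forall>B\<in>L. A \<subseteq> B \<longrightarrow> B \<in> G" unfolding G_def by (blast intro: subset_trans)
      show "{} \<notin> G" unfolding G_def using n by blast
    qed (use F(1) in \<open>auto simp: G_def\<close>)
    moreover have "D \<in> G" unfolding G_def using D(1) AB(3) by blast
    ultimately show False using D(2) by blast
  qed
  obtain C C' where "C \<in> F" "C' \<in> F" "C \<inter> A = {}" "C' \<inter> B = {}"
    using disj AB(1,2) neg by meson
  then have "(C \<inter> C') \<inter> (A \<union> B) \<in> F" "(C \<inter> C') \<inter> (A \<union> B) = {}"
    using F(3) AB(3) by auto
  then show False using F(2) by metis
qed

lemma closed_discrete_Un:
  fixes A B :: "'a::topological_space set"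
  assumes "closed A" "discrete A" "closed B" "discrete B"
  shows "closed (A \<union> B) \<and> discrete (A \<union> B)"
  using assms by (auto simp: discrete_def isolated_in_islimpt_iff islimpt_Un closed_limpt)

lemma closed_discrete_sets_Int:
  "A \<in> closed_discrete_sets \<Longrightarrow> B \<in> closed_discrete_sets \<Longrightarrow> A \<inter> B \<in> closed_discrete_sets"
  unfolding closed_discrete_sets_def by (auto intro: discrete_subset)

lemma discrete_z_ultrafilter_Un_iff:
  assumes p: "discrete_z_ultrafilter p"
    and Z: "closed Z" "discrete Z" and W: "closed W" "discrete W"
  shows "Z \<union> W \<in> p \<longleftrightarrow> Z \<in> p \<or> W \<in> p"
proof
  have flt: "discrete_z_filter p"
    using p by (simp add: discrete_z_ultrafilter_def)
  assume ZW: "Z \<union> W \<in> p"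
  show "Z \<in> p \<or> W \<in> p"
  proof (rule maximal_filter_prime[where L = closed_discrete_sets])
    show "p \<subseteq> closed_discrete_sets" "{} \<notin> p"
      using flt by (simp_all add: discrete_z_filter_def)
    show "A \<inter> B \<in> p" if "A \<in> p" "B \<in> p" for A B
      using flt that by (simp add: discrete_z_filter_def)
    show "Z \<in> closed_discrete_sets" "W \<in> closed_discrete_sets"
      using Z W by (simp_all add: closed_discrete_sets_def)
    fix G assume "G \<subseteq> closed_discrete_sets" "{} \<notin> G" "\<forall>A\<in>G. \<forall>B\<in>G. A \<inter> B \<in> G"
      "\<forall>A\<in>G. \<forall>B\<in>closed_discrete_sets. A \<subseteq> B \<longrightarrow> B \<in> G" "p \<subseteq> G"
    then show "G = p"
      using p unfolding discrete_z_ultrafilter_def discrete_z_filter_def by simp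
  qed (fact closed_discrete_sets_Int ZW)+
next
  have up: "\<forall>D1\<in>p. \<forall>D\<in>closed_discrete_sets. D1 \<subseteq> D \<longrightarrow> D \<in> p"
    using p unfolding discrete_z_ultrafilter_def discrete_z_filter_def by simp
  have "Z \<union> W \<in> closed_discrete_sets"
    using closed_discrete_Un Z W by (auto simp: closed_discrete_sets_def)
  moreover assume "Z \<in> p \<or> W \<in> p"
  ultimately show "Z \<union> W \<in> p"
    using up Un_upper1 Un_upper2 by metis
qed

lemma closed_ultrafilter_Un_iff:
  assumes u: "closed_ultrafilter X u" and A: "closedin X A" and B: "closedin X B"
  shows "A \<union> B \<in> u \<longleftrightarrow> A \<in> u \<or> B \<in> u"
proof
  have flt: "closed_filter X u"
    using u by (simp add: closed_ultrafilter_def)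
  assume AB: "A \<union> B \<in> u"
  show "A \<in> u \<or> B \<in> u"
  proof (rule maximal_filter_prime[where L = "{A. closedin X A}"])
    show "u \<subseteq> {A. closedin X A}" "{} \<notin> u"
      using flt by (simp_all add: closed_filter_def)
    show "C \<inter> D \<in> u" if "C \<in> u" "D \<in> u" for C D
      using flt that by (simp add: closed_filter_def)
    show "C \<inter> D \<in> {A. closedin X A}" if "C \<in> {A. closedin X A}" "D \<in> {A. closedin X A}" for C D
      using that by (simp add: closedin_Int)
    show "A \<in> {A. closedin X A}" "B \<in> {A. closedin X A}"
      using A B by simp_all
    fix G assume G: "G \<subseteq> {A. closedin X A}" "{} \<notin> G" "\<forall>A\<in>G. \<forall>B\<in>G. A \<inter> B \<in> G"
      "\<forall>A\<in>G. \<forall>B\<in>{A. closedin X A}. A \<subseteq> B \<longrightarrow> B \<in> G" "u \<subseteq> G"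
    have "G \<noteq> {}" using AB G(5) by blast
    then have "closed_filter X G"
      using G(1-4) by (simp only: closed_filter_def Ball_def mem_Collect_eq) blast
    then show "G = u"
      using u G(5) by (simp add: closed_ultrafilter_def)
  qed (fact AB)
next
  have up: "\<forall>C\<in>u. \<forall>D. closedin X D \<and> C \<subseteq> D \<longrightarrow> D \<in> u"
    using u unfolding closed_ultrafilter_def closed_filter_def by simp
  assume "A \<in> u \<or> B \<in> u"
  then show "A \<union> B \<in> u"
    using up closedin_Un[OF A B] Un_upper1 Un_upper2 by metis
qed

lemma theta_base_Un:
  assumes "B \<in> {{p. discrete_z_ultrafilter p \<and> Z \<in> p} | Z. closed Z \<and> discrete Z}"
    and "C \<in> {{p. discrete_z_ultrafilter p \<and> Z \<in> p} | Z. closed Z \<and> discrete Z}"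
  shows "B \<union> C \<in> {{p. discrete_z_ultrafilter p \<and> Z \<in> p} | Z. closed Z \<and> discrete Z}"
proof -
  obtain Z W where Z: "closed Z" "discrete Z" "B = {p. discrete_z_ultrafilter p \<and> Z \<in> p}"
    and W: "closed W" "discrete W" "C = {p. discrete_z_ultrafilter p \<and> W \<in> p}"
    using assms by blast
  have "B \<union> C = {p. discrete_z_ultrafilter p \<and> Z \<union> W \<in> p}"
    unfolding Z(3) W(3) using discrete_z_ultrafilter_Un_iff[OF _ Z(1,2) W(1,2)] by blast
  then show ?thesis using closed_discrete_Un[OF Z(1,2) W(1,2)] by blast
qed

lemma wallman_base_Un:
  assumes "B \<in> {{u. closed_ultrafilter X u \<and> A \<in> u} | A. closedin X A}"
    and "C \<in> {{u. closed_ultrafilter X u \<and> A \<in> u} | A. closedin X A}"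
  shows "B \<union> C \<in> {{u. closed_ultrafilter X u \<and> A \<in> u} | A. closedin X A}"
proof -
  obtain A A' where A: "closedin X A" "B = {u. closed_ultrafilter X u \<and> A \<in> u}"
    and A': "closedin X A'" "C = {u. closed_ultrafilter X u \<and> A' \<in> u}"
    using assms by blast
  have "B \<union> C = {u. closed_ultrafilter X u \<and> A \<union> A' \<in> u}"
    unfolding A(2) A'(2) using closed_ultrafilter_Un_iff[OF _ A(1) A'(1)] by blast
  then show ?thesis using closedin_Un[OF A(1) A'(1)] by blast
qed

lemma openin_theta:
  "openin (theta :: 'a::topological_space set set topology) = arbitrary union_of
     (\<lambda>U. \<exists>Z::'a set. closed Z \<and> discrete Z \<and> U = {p. discrete_z_ultrafilter p \<and> Z \<notin> p})"
proof -
  have "openin (theta :: 'a set set topology) = arbitrary union_of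
      (\<lambda>U. \<exists>C\<in>{{p. discrete_z_ultrafilter p \<and> Z \<in> p} | Z::'a set. closed Z \<and> discrete Z}.
         U = {p. discrete_z_ultrafilter p} - C)"
    unfolding theta_def by (rule openin_topology_with_closed_base) (rule theta_base_Un)
  also have "(\<lambda>U. \<exists>C\<in>{{p. discrete_z_ultrafilter p \<and> Z \<in> p} | Z::'a set. closed Z \<and> discrete Z}.
         U = {p. discrete_z_ultrafilter p} - C) =
      (\<lambda>U. \<exists>Z::'a set. closed Z \<and> discrete Z \<and> U = {p. discrete_z_ultrafilter p \<and> Z \<notin> p})"
  proof (rule ext)
    fix U :: "'a set set set"
    have eq: "{p. discrete_z_ultrafilter p} - {p. discrete_z_ultrafilter p \<and> Z \<in> p} =
        {p. discrete_z_ultrafilter p \<and> Z \<notin> p}" for Z :: "'a set"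
      by blast
    show "(\<exists>C\<in>{{p. discrete_z_ultrafilter p \<and> Z \<in> p} | Z::'a set. closed Z \<and> discrete Z}.
         U = {p. discrete_z_ultrafilter p} - C) \<longleftrightarrow>
      (\<exists>Z::'a set. closed Z \<and> discrete Z \<and> U = {p. discrete_z_ultrafilter p \<and> Z \<notin> p})"
      by (simp only: setcompr_eq_image bex_simps eq) (simp add: Bex_def)
  qed
  finally show ?thesis .
qed

lemma topspace_theta: "topspace theta = {p. discrete_z_ultrafilter p}"
  unfolding theta_def
proof (rule topspace_topology_with_closed_base)
  show "{} \<in> {{p. discrete_z_ultrafilter p \<and> Z \<in> p} | Z. closed Z \<and> discrete Z}"
    by (rule CollectI, rule exI[of _ "{}"])
      (auto simp: discrete_z_ultrafilter_def discrete_z_filter_def)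
qed (rule theta_base_Un)

lemma openin_wallman_space:
  "openin (wallman_space X) = arbitrary union_of
     (\<lambda>U. \<exists>A. closedin X A \<and> U = {u. closed_ultrafilter X u \<and> A \<notin> u})"
proof -
  have "openin (wallman_space X) = arbitrary union_of
      (\<lambda>U. \<exists>C\<in>{{u. closed_ultrafilter X u \<and> A \<in> u} | A. closedin X A}.
         U = {u. closed_ultrafilter X u} - C)"
    unfolding wallman_space_def by (rule openin_topology_with_closed_base) (rule wallman_base_Un)
  also have "(\<lambda>U. \<exists>C\<in>{{u. closed_ultrafilter X u \<and> A \<in> u} | A. closedin X A}.
         U = {u. closed_ultrafilter X u} - C) =
      (\<lambda>U. \<exists>A. closedin X A \<and> U = {u. closed_ultrafilter X u \<and> A \<notin> u})"
  proof (rule ext)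
    fix U
    have eq: "{u. closed_ultrafilter X u} - {u. closed_ultrafilter X u \<and> A \<in> u} =
        {u. closed_ultrafilter X u \<and> A \<notin> u}" for A
      by blast
    show "(\<exists>C\<in>{{u. closed_ultrafilter X u \<and> A \<in> u} | A. closedin X A}.
         U = {u. closed_ultrafilter X u} - C) \<longleftrightarrow>
      (\<exists>A. closedin X A \<and> U = {u. closed_ultrafilter X u \<and> A \<notin> u})"
      by (simp add: setcompr_eq_image Bex_def eq)
  qed
  finally show ?thesis .
qed

lemma topspace_wallman_space: "topspace (wallman_space X) = {u. closed_ultrafilter X u}"
  unfolding wallman_space_def
proof (rule topspace_topology_with_closed_base)
  show "{} \<in> {{u. closed_ultrafilter X u \<and> A \<in> u} | A. closedin X A}"
    by (rule CollectI, rule exI[of _ "{}"]) (auto simp: closed_ultrafilter_def closed_filter_def)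
qed (rule wallman_base_Un)

lemma discrete_z_ultrafilter_eta:
  fixes a :: "'a::t1_space"
  shows "discrete_z_ultrafilter (eta a)"
proof -
  have filt: "discrete_z_filter (eta a)"
    by (simp add: discrete_z_filter_def eta_def closed_discrete_sets_Int subset_iff)
  have "discrete {a}" by (auto simp: discrete_def isolated_in_def)
  then have a: "{a} \<in> eta a" by (simp add: eta_def closed_discrete_sets_def)
  have "G = eta a" if G: "discrete_z_filter G" "eta a \<subseteq> G" for G
  proof -
    have "a \<in> D" if "D \<in> G" for D
    proof (rule ccontr)
      assume "a \<notin> D"
      then have "{a} \<inter> D = {}" by blast
      moreover have "{a} \<inter> D \<in> G"
        using G(1) subsetD[OF G(2) a] that by (simp add: discrete_z_filter_def)
      ultimately show False using G(1) by (simp add: discrete_z_filter_def)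
    qed
    then have "G \<subseteq> eta a"
      using G(1) by (auto simp: discrete_z_filter_def eta_def)
    then show ?thesis using G(2) by (rule subset_antisym)
  qed
  then show ?thesis using filt by (simp add: discrete_z_ultrafilter_def)
qed

end

theory Submission
  imports Defs
begin

text \<open>
  The argument works over every \<open>T\<^sub>1\<close> space, not only over the real and the complex numbers. The
  family \<^term>\<open>closed_discrete_sets\<close> contains the whole space and is closed under finite unions and,
  since a closed subset of a closed discrete set is closed discrete, under arbitrary intersections.
  It is therefore the family of all closed sets of a second, coarser topology on the same points.

  The subspace topology that \<^term>\<open>range eta\<close> inherits from \<^term>\<open>theta\<close> is a copy of this coarser
  topology: the basic closed set given by \<open>Z\<close> meets \<^term>\<open>range eta\<close> in the image of \<open>Z\<close>, because the
  fixed ultrafilter at \<open>a\<close> contains \<open>Z\<close> exactly when \<open>a \<in> Z\<close>; and intersections of such traces are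
  again of this form (\<open>closedin_range_eta_iff\<close>). Taking images under \<^term>\<open>eta\<close> is thus an isomorphism
  from the lattice \<^term>\<open>closed_discrete_sets\<close> onto the lattice of closed subsets of
  \<^term>\<open>range eta\<close>. It carries discrete z-ultrafilters bijectively to ultrafilters of closed sets
  (\<open>closed_ultrafilter_image_iff\<close>), basic closed sets to basic closed sets, and fixed ultrafilters
  to fixed ultrafilters, which is all that a Wallman compactification asks for.

  Two differences between the definitions on the two sides have to be bridged. Filters of
  closed sets are nonempty by definition and discrete z-filters are not, but maximality excludes
  the empty discrete z-filter. The base of the Wallman space also has a member given by
  the whole space, even if that is not discrete; it is the set of all ultrafilters, which is closed
  in any case.
\<close>

section \<open>The closed subsets of the embedded space\<close>

lemma closed_discrete_sets_Inter:
  assumes "\<M> \<subseteq> closed_discrete_sets"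
  shows "\<Inter>\<M> \<in> closed_discrete_sets"
proof (cases "\<M> \<subseteq> {UNIV}")
  case True
  then have "\<Inter>\<M> = UNIV" by blast
  then show ?thesis by (simp add: closed_discrete_sets_def)
next
  case False
  then obtain Z where Z: "Z \<in> \<M>" "discrete Z"
    using assms by (auto simp: closed_discrete_sets_def)
  have "\<forall>D\<in>\<M>. closed D"
    using assms by (auto simp: closed_discrete_sets_def)
  then have "closed (\<Inter>\<M>)" by (rule closed_Inter)
  moreover have "discrete (\<Inter>\<M>)"
    using Z(2) by (rule discrete_subset) (use Z(1) in blast)
  ultimately show ?thesis by (simp add: closed_discrete_sets_def)
qed

lemma mem_eta_iff: "D \<in> closed_discrete_sets \<Longrightarrow> D \<in> eta a \<longleftrightarrow> a \<in> D"
  by (simp add: eta_def)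

text \<open>The \<open>T\<^sub>1\<close> hypothesis enters here. Singletons are what separates the fixed ultrafilters at
  different points, and what makes their images under \<^term>\<open>eta\<close> closed.\<close>

lemma singleton_mem_closed_discrete_sets: "{a :: 'a::t1_space} \<in> closed_discrete_sets"
  by (auto simp: closed_discrete_sets_def discrete_def isolated_in_def)

lemma inj_eta: "inj (eta :: 'a::t1_space \<Rightarrow> 'a set set)"
proof (rule injI)
  fix a b :: 'a
  assume eq: "eta a = eta b"
  have "{a} \<in> eta b"
    by (simp add: mem_eta_iff singleton_mem_closed_discrete_sets flip: eq)
  then show "a = b" by (simp add: eta_def)
qed

lemma openin_theta_Union_basic:
  fixes T :: "'a::topological_space set set set"
  assumes "openin theta T"
  obtains \<U> where "T = \<Union>\<U>"
    and "\<forall>U\<in>\<U>.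
      \<exists>Z::'a set. closed Z \<and> discrete Z \<and> U = {p. discrete_z_ultrafilter p \<and> Z \<notin> p}"
proof -
  from assms obtain \<U> where "\<Union>\<U> = T" and sub: "\<U> \<subseteq>
      {U. \<exists>Z::'a set. closed Z \<and> discrete Z \<and> U = {p. discrete_z_ultrafilter p \<and> Z \<notin> p}}"
    unfolding openin_theta union_of_def by (elim exE conjE) (rule that)
  show ?thesis
  proof (rule that)
    show "T = \<Union>\<U>" by (rule sym) fact
    show "\<forall>U\<in>\<U>. \<exists>Z::'a set. closed Z \<and> discrete Z \<and>
        U = {p. discrete_z_ultrafilter p \<and> Z \<notin> p}"
      by (intro ballI) (drule subsetD[OF sub], simp only: mem_Collect_eq)
  qed
qed

lemma openin_theta_basic:
  assumes "closed Z" "discrete Z"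
  shows "openin theta {p. discrete_z_ultrafilter p \<and> Z \<notin> p}"
  unfolding openin_theta
  by (rule arbitrary_union_of_inc, rule exI[of _ Z], intro conjI refl assms)

text \<open>Preimages under \<^term>\<open>eta\<close> of open sets are complements of members of
  \<^term>\<open>closed_discrete_sets\<close>: for a basic open set this holds because fixed filters at points of a
  \<open>T\<^sub>1\<close> space are maximal, hence points of \<^term>\<open>theta\<close>, and contain \<open>Z\<close> exactly at the points of \<open>Z\<close>;
  and a union of basic open sets corresponds to an intersection of closed discrete sets.\<close>

lemma eta_vimage_openin_theta:
  fixes T :: "'a::t1_space set set set"
  assumes "openin theta T"
  shows "- (eta -` T) \<in> closed_discrete_sets"
proof -
  obtain \<U> where T: "T = \<Union>\<U>"
    and basic: "\<forall>U\<in>\<U>.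
      \<exists>Z::'a set. closed Z \<and> discrete Z \<and> U = {p. discrete_z_ultrafilter p \<and> Z \<notin> p}"
    using openin_theta_Union_basic[OF assms] .
  have "- (eta -` U) \<in> closed_discrete_sets" if U: "U \<in> \<U>" for U
  proof -
    obtain Z :: "'a set" where Z: "closed Z" "discrete Z"
      and eq: "U = {p. discrete_z_ultrafilter p \<and> Z \<notin> p}"
      using bspec[OF basic U] by blast
    have ZD: "Z \<in> closed_discrete_sets" using Z by (simp add: closed_discrete_sets_def)
    then have "- (eta -` U) = Z"
      by (auto simp: eq mem_eta_iff discrete_z_ultrafilter_eta)
    then show ?thesis using ZD by simp
  qed
  then have "\<Inter>((\<lambda>U. - (eta -` U)) ` \<U>) \<in> closed_discrete_sets"
    by (intro closed_discrete_sets_Inter) blast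
  moreover have "- (eta -` T) = \<Inter>((\<lambda>U. - (eta -` U)) ` \<U>)"
    unfolding T by blast
  ultimately show ?thesis by simp
qed

lemma range_eta_subset_topspace_theta:
  "range (eta :: 'a::t1_space \<Rightarrow> 'a set set) \<subseteq> topspace theta"
  by (auto simp: topspace_theta discrete_z_ultrafilter_eta)

lemma closedin_range_eta_iff:
  fixes A :: "'a::t1_space set set set"
  shows "closedin (subtopology theta (range eta)) A \<longleftrightarrow> A \<in> (`) eta ` closed_discrete_sets"
proof
  assume "closedin (subtopology theta (range eta)) A"
  then obtain C where C: "closedin theta C" and A: "A = C \<inter> range eta"
    by (auto simp: closedin_subtopology)
  have "- (eta -` (topspace theta - C)) \<in> closed_discrete_sets"
    by (intro eta_vimage_openin_theta openin_diff openin_topspace C)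
  moreover have "A = eta ` (- (eta -` (topspace theta - C)))"
    unfolding A using range_eta_subset_topspace_theta by fast
  ultimately show "A \<in> (`) eta ` closed_discrete_sets" by blast
next
  assume "A \<in> (`) eta ` closed_discrete_sets"
  then obtain D :: "'a set" where D: "D \<in> closed_discrete_sets" and A: "A = eta ` D" by blast
  show "closedin (subtopology theta (range eta)) A"
  proof (cases "D = UNIV")
    case True
    have "topspace (subtopology theta (range (eta :: 'a \<Rightarrow> _))) = range eta"
      by (simp only: topspace_subtopology Int_absorb1 range_eta_subset_topspace_theta)
    then show ?thesis
      using closedin_topspace[of "subtopology theta (range (eta :: 'a \<Rightarrow> _))"] by (simp only: A True)
  next
    case False
    then have Z: "closed D" "discrete D" using D by (auto simp: closed_discrete_sets_def)
    have "closedin theta (topspace theta - {p. discrete_z_ultrafilter p \<and> D \<notin> p})"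
      by (intro closedin_diff closedin_topspace openin_theta_basic Z)
    moreover have "A = (topspace theta - {p. discrete_z_ultrafilter p \<and> D \<notin> p}) \<inter> range eta"
      unfolding A by (auto simp: topspace_theta discrete_z_ultrafilter_eta mem_eta_iff[OF D])
    ultimately show ?thesis unfolding closedin_subtopology by blast
  qed
qed

lemma t1_space_range_eta:
  "t1_space (subtopology theta (range (eta :: 'a::t1_space \<Rightarrow> 'a set set)))"
proof -
  have "closedin (subtopology theta (range eta)) {eta a}" for a :: 'a
  proof -
    have "eta ` {a} \<in> (`) eta ` closed_discrete_sets"
      by (intro imageI singleton_mem_closed_discrete_sets)
    then show ?thesis by (simp add: closedin_range_eta_iff)
  qed
  then show ?thesis by (auto simp: t1_space_closedin_singleton)
qed

section \<open>Transport of ultrafilters along a lattice isomorphism\<close>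

lemma inj_image: "inj f \<Longrightarrow> inj ((`) f)"
  by (simp add: inj_image_eq_iff inj_def)

lemma UNIV_mem_discrete_z_ultrafilter:
  fixes p :: "'a::topological_space set set"
  assumes "discrete_z_ultrafilter p"
  shows "UNIV \<in> p"
proof (cases "p = {}")
  case True
  \<comment> \<open>The empty family is a discrete z-filter, but it is properly contained in \<open>{UNIV}\<close>.\<close>
  have "discrete_z_filter {UNIV :: 'a set}"
    by (auto simp: discrete_z_filter_def closed_discrete_sets_def)
  then show ?thesis using assms True by (auto simp: discrete_z_ultrafilter_def)
next
  case False
  then obtain D where "D \<in> p" by blast
  moreover have "UNIV \<in> (closed_discrete_sets :: 'a set set)"
    by (simp add: closed_discrete_sets_def)
  moreover have "\<forall>D\<in>p. \<forall>E\<in>closed_discrete_sets. D \<subseteq> E \<longrightarrow> E \<in> p"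
    using assms by (simp add: discrete_z_ultrafilter_def discrete_z_filter_def)
  ultimately show ?thesis using subset_UNIV by metis
qed

text \<open>For an injective \<open>f\<close>, taking images commutes with intersections and reflects inclusions and
  emptiness, so every clause in the definition of a filter can be read on either side.\<close>

lemma closed_filter_image_iff:
  fixes f :: "'a::topological_space \<Rightarrow> 'b"
  assumes f: "inj f" and X: "\<And>A. closedin X A \<longleftrightarrow> A \<in> (`) f ` closed_discrete_sets"
  shows "closed_filter X ((`) f ` p) \<longleftrightarrow> discrete_z_filter p \<and> p \<noteq> {}"
proof -
  have mem: "f ` D \<in> (`) f ` F \<longleftrightarrow> D \<in> F" for D F
    using f by (auto simp: inj_image_eq_iff)
  have members: "(`) f ` p \<subseteq> {A. closedin X A} \<longleftrightarrow> p \<subseteq> closed_discrete_sets"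
    by (auto simp: X mem image_subset_iff)
  have nonempty: "{} \<notin> (`) f ` p \<longleftrightarrow> {} \<notin> p"
    by auto
  have inter: "(\<forall>A\<in>(`) f ` p. \<forall>B\<in>(`) f ` p. A \<inter> B \<in> (`) f ` p) \<longleftrightarrow>
      (\<forall>D\<in>p. \<forall>E\<in>p. D \<inter> E \<in> p)"
    by (simp add: mem flip: image_Int[OF f])
  have upward: "(\<forall>A\<in>(`) f ` p. \<forall>B. closedin X B \<and> A \<subseteq> B \<longrightarrow> B \<in> (`) f ` p) \<longleftrightarrow>
      (\<forall>D\<in>p. \<forall>E\<in>closed_discrete_sets. D \<subseteq> E \<longrightarrow> E \<in> p)" (is "?L \<longleftrightarrow> ?R")
  proof -
    have "?L \<longleftrightarrow> (\<forall>A\<in>(`) f ` p. \<forall>B\<in>(`) f ` closed_discrete_sets. A \<subseteq> B \<longrightarrow> B \<in> (`) f ` p)"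
      by (simp only: X) blast
    also have "\<dots> \<longleftrightarrow> ?R"
      by (simp add: mem inj_image_subset_iff[OF f])
    finally show ?thesis .
  qed
  show ?thesis
    by (simp only: closed_filter_def discrete_z_filter_def members nonempty inter upward image_is_empty conj_ac)
qed

lemma closed_filter_is_image:
  assumes X: "\<And>A. closedin X A \<longleftrightarrow> A \<in> (`) f ` closed_discrete_sets"
    and u: "closed_filter X u"
  obtains p where "u = (`) f ` p"
proof -
  have "u \<subseteq> (`) f ` closed_discrete_sets"
    using u X by (auto simp: closed_filter_def)
  then show ?thesis using that by (auto simp: subset_image_iff)
qed

text \<open>Maximality is transported because taking images is an order isomorphism from the nonempty
  discrete z-filters onto the filters of closed sets.\<close>

lemma closed_ultrafilter_image_iff:
  fixes f :: "'a::topological_space \<Rightarrow> 'b"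
  assumes f: "inj f" and X: "\<And>A. closedin X A \<longleftrightarrow> A \<in> (`) f ` closed_discrete_sets"
  shows "closed_ultrafilter X ((`) f ` p) \<longleftrightarrow> discrete_z_ultrafilter p"
proof -
  have inj: "inj ((`) f)" using f by (rule inj_image)
  note filter_iff = closed_filter_image_iff[OF f X]
  show ?thesis
  proof
    assume u: "closed_ultrafilter X ((`) f ` p)"
    then have p: "discrete_z_filter p" "p \<noteq> {}"
      using filter_iff by (auto simp: closed_ultrafilter_def)
    have "q = p" if q: "discrete_z_filter q" "p \<subseteq> q" for q
    proof -
      have "closed_filter X ((`) f ` q)" using q p(2) filter_iff by blast
      moreover have "(`) f ` p \<subseteq> (`) f ` q" using q(2) by (rule image_mono)
      ultimately have "(`) f ` q = (`) f ` p"
        using u unfolding closed_ultrafilter_def by (elim conjE allE impE) (intro conjI)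
      then show ?thesis by (simp add: inj_image_eq_iff[OF inj])
    qed
    then show "discrete_z_ultrafilter p" using p(1) by (simp add: discrete_z_ultrafilter_def)
  next
    assume p: "discrete_z_ultrafilter p"
    then have "p \<noteq> {}" using UNIV_mem_discrete_z_ultrafilter by blast
    then have "closed_filter X ((`) f ` p)"
      using p filter_iff by (simp add: discrete_z_ultrafilter_def)
    moreover have "v = (`) f ` p" if v: "closed_filter X v" "(`) f ` p \<subseteq> v" for v
    proof -
      obtain q where q: "v = (`) f ` q" using closed_filter_is_image[OF X v(1)] .
      have "discrete_z_filter q" using v(1) filter_iff by (simp add: q)
      moreover have "p \<subseteq> q" using v(2) by (simp add: q inj_image_subset_iff[OF inj])
      ultimately have "q = p" using p unfolding discrete_z_ultrafilter_def by blast
      then show ?thesis by (simp only: q)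
    qed
    ultimately show "closed_ultrafilter X ((`) f ` p)" by (simp add: closed_ultrafilter_def)
  qed
qed

section \<open>The homeomorphism with the Wallman space\<close>

text \<open>The map of ultrafilters is a bijection that matches the basic closed set of \<open>Z\<close> with that of
  \<open>f ` Z\<close>. The two bases differ at most in the basic closed set of the whole space, whose complement
  is empty since every ultrafilter contains the whole space.\<close>

lemma homeomorphic_map_theta_wallman_space:
  fixes f :: "'a::topological_space \<Rightarrow> 'b"
  assumes f: "inj f" and X: "\<And>A. closedin X A \<longleftrightarrow> A \<in> (`) f ` closed_discrete_sets"
  shows "homeomorphic_map theta (wallman_space X) ((`) ((`) f))"
proof -
  let ?h = "(`) ((`) f)"
  have inj: "inj ((`) f)" using f by (rule inj_image)
  note ultra_iff = closed_ultrafilter_image_iff[OF f X]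
  have mem: "f ` D \<in> ?h p \<longleftrightarrow> D \<in> p" for D p
    by (simp add: inj_image_mem_iff[OF inj])
  have surj: "\<exists>p. discrete_z_ultrafilter p \<and> u = ?h p" if u: "closed_ultrafilter X u" for u
  proof -
    have "closed_filter X u" using u by (simp add: closed_ultrafilter_def)
    then obtain p where "u = ?h p" by (rule closed_filter_is_image[OF X])
    then show ?thesis using u ultra_iff by auto
  qed
  have image: "?h ` topspace theta = topspace (wallman_space X)"
  proof (unfold topspace_theta topspace_wallman_space, intro equalityI subsetI)
    fix u assume "u \<in> {u. closed_ultrafilter X u}"
    then show "u \<in> ?h ` {p. discrete_z_ultrafilter p}" using surj by (simp add: image_iff)
  qed (auto simp: ultra_iff)
  show ?thesis
  proof (rule bijective_open_imp_homeomorphic_map)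
    show "continuous_map theta (wallman_space X) ?h"
      unfolding continuous_map_openin_preimage_eq
    proof (intro conjI allI impI)
      show "?h \<in> topspace theta \<rightarrow> topspace (wallman_space X)" using image by blast
      fix V assume "openin (wallman_space X) V"
      then obtain \<V> where V: "V = \<Union>\<V>"
        and basic: "\<And>W. W \<in> \<V> \<Longrightarrow> \<exists>A. closedin X A \<and> W = {u. closed_ultrafilter X u \<and> A \<notin> u}"
        unfolding openin_wallman_space union_of_def by blast
      have "openin theta (topspace theta \<inter> ?h -` W)" if W: "W \<in> \<V>" for W
      proof -
        obtain D where D: "D \<in> closed_discrete_sets"
          and W: "W = {u. closed_ultrafilter X u \<and> f ` D \<notin> u}"
        proof -
          obtain A where A: "closedin X A" "W = {u. closed_ultrafilter X u \<and> A \<notin> u}"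
            using basic[OF W] by blast
          from A(1) obtain D where "D \<in> closed_discrete_sets" "A = f ` D"
            unfolding X by blast
          then show ?thesis using that A(2) by blast
        qed
        have eq: "topspace theta \<inter> ?h -` W = {p. discrete_z_ultrafilter p \<and> D \<notin> p}"
          by (auto simp: W topspace_theta ultra_iff mem)
        show ?thesis
        proof (cases "D = UNIV")
          case True
          then have "topspace theta \<inter> ?h -` W = {}"
            unfolding eq using UNIV_mem_discrete_z_ultrafilter by blast
          then show ?thesis by (simp only: openin_empty)
        next
          case False
          then have "closed D" "discrete D" using D by (auto simp: closed_discrete_sets_def)
          then show ?thesis unfolding eq by (rule openin_theta_basic)
        qed
      qed
      then have "openin theta (\<Union>W\<in>\<V>. topspace theta \<inter> ?h -` W)" by (intro openin_Union) blast
      moreover have "topspace theta \<inter> ?h -` V = (\<Union>W\<in>\<V>. topspace theta \<inter> ?h -` W)"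
        unfolding V by blast
      ultimately show "openin theta (topspace theta \<inter> ?h -` V)" by (simp only:)
    qed
    show "open_map theta (wallman_space X) ?h"
      unfolding open_map_def
    proof (intro allI impI)
      fix U :: "'a set set set" assume U: "openin theta U"
      obtain \<U> where U: "U = \<Union>\<U>"
        and basic: "\<forall>W\<in>\<U>.
          \<exists>Z::'a set. closed Z \<and> discrete Z \<and> W = {p. discrete_z_ultrafilter p \<and> Z \<notin> p}"
        using openin_theta_Union_basic[OF U] .
      have "openin (wallman_space X) (?h ` W)" if W: "W \<in> \<U>" for W
      proof -
        obtain Z where Z: "closed Z" "discrete Z"
          and W: "W = {p. discrete_z_ultrafilter p \<and> Z \<notin> p}"
          using bspec[OF basic W] by blast
        have eq: "?h ` W = {u. closed_ultrafilter X u \<and> f ` Z \<notin> u}"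
        proof (intro equalityI subsetI)
          fix u assume u: "u \<in> {u. closed_ultrafilter X u \<and> f ` Z \<notin> u}"
          then obtain p where "discrete_z_ultrafilter p" "u = ?h p" using surj by blast
          then show "u \<in> ?h ` W" using u by (simp add: W mem)
        qed (auto simp: W ultra_iff inj_image_eq_iff[OF f])
        have "closedin X (f ` Z)"
          using Z by (auto simp: X closed_discrete_sets_def)
        then show ?thesis
          unfolding openin_wallman_space eq
          by (intro arbitrary_union_of_inc exI[of _ "f ` Z"]) simp
      qed
      then have "openin (wallman_space X) (\<Union>W\<in>\<U>. ?h ` W)" by (intro openin_Union) blast
      then show "openin (wallman_space X) (?h ` U)" by (simp only: U image_Union)
    qed
    show "inj_on ?h (topspace theta)"
      using inj_image[OF inj] by (rule inj_on_subset) simp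
  qed (fact image)
qed

theorem wallman_compactification_theta:
  "wallman_compactification_of theta (range (eta :: 'a::t1_space \<Rightarrow> 'a set set))"
  unfolding wallman_compactification_of_def
proof (intro conjI exI ballI)
  let ?S = "subtopology theta (range (eta :: 'a \<Rightarrow> 'a set set))"
  show "homeomorphic_map theta (wallman_space ?S) ((`) ((`) eta))"
    by (rule homeomorphic_map_theta_wallman_space[OF inj_eta closedin_range_eta_iff])
  fix x assume "x \<in> range (eta :: 'a \<Rightarrow> 'a set set)"
  then obtain a :: 'a where x: "x = eta a" by blast
  have embedding: "wallman_embedding ?S (eta a) = (`) eta ` {D \<in> closed_discrete_sets. a \<in> D}"
    by (auto simp: wallman_embedding_def closedin_range_eta_iff inj_eq[OF inj_eta])
  show "(`) eta ` x = wallman_embedding ?S x"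
    unfolding x embedding by (simp only: eta_def[of a])
qed (fact range_eta_subset_topspace_theta t1_space_range_eta)+

theorem theorem3p15:
  shows "wallman_compactification_of (theta :: real set set topology) (range eta)
       \<and> wallman_compactification_of (theta :: complex set set topology) (range eta)"
  by (intro conjI wallman_compactification_theta)

end
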